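(* Let $\mu_0, \nu_0 \in \mathcal P_c^*(\mathbb R^2)$ be template measures with $\mathcal N_{\mathrm m}[\mu_0] \neq \mathcal N_{\mathrm m}[\nu_0]$, and define $$c_\mu := \min_{\boldsymbol\theta\in\mathbb S_1} \operatorname{std}(\widehat{\mathcal R}_{\boldsymbol\theta}[\mu_0]), \qquad c_\nu := \min_{\boldsymbol\theta\in\mathbb S_1} \operatorname{std}(\widehat{\mathcal R}_{\boldsymbol\theta}[\nu_0]).$$ Let $0 \le \epsilon < \tfrac{\min\{c_\mu,c_\nu\}}{2}$ satisfy $$4\epsilon\left(\frac{\operatorname{diam}(\mu_0)+2\epsilon}{c_\mu(c_\mu-2\epsilon)} + \frac{\operatorname{diam}(\nu_0)+2\epsilon}{c_\nu(c_\nu-2\epsilon)}\right) < \lVert \mathcal N_{\mathrm m}[\mu_0]-\mathcal N_{\mathrm m}[\nu_0]\rVert_\infty .$$ Consider the classes $$\mathbb F = \{(\mathbf A\cdot+\mathbf y)_\#\mu \mid \mathbf A\in \mathrm{GL}(2),\ \mathbf y\in\mathbb R^2,\ \mu\in\mathcal P(\mathbb R^2),\ W_\infty(\mu,\mu_0)\le\epsilon\},$$ $$\mathbb G = \{(\mathbf A\cdot+\mathbf y)_\#\nu \mid \mathbf A\in \mathrm{GL}(2),\ \mathbf y\in\mathbb R^2,\ \nu\in\mathcal P(\mathbb R^2),\ W_\infty(\nu,\nu_0)\le\epsilon\}.$$ Then any non-empty subsets $\mathbb F_0\subseteq\mathbb F$ and $\mathbb G_0\subseteq\mathbb G$ are linearly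 separable in max-normalized R-CDT space, i.e. there exist a continuous linear functional $\Phi\colon L^\infty_\rho(\mathbb R)\to\mathbb R$ and a constant $c\in\mathbb R$ such that $$\Phi(\mathcal N_{\mathrm m}[\mu]) < c < \Phi(\mathcal N_{\mathrm m}[\nu]) \qquad \text{for all } \mu\in\mathbb F_0,\ \nu\in\mathbb G_0 .$$
   Context: $\mathcal P(X)$ denotes the Borel probability measures on $X$, and $T_\#\mu=\mu\circ T^{-1}$ the push-forward. $\mathbb S_1=\{\boldsymbol\theta\in\mathbb R^2: \lVert\boldsymbol\theta\rVert=1\}$. For $\mu\in\mathcal P(\mathbb R^2)$, $\dim(\mu)$ is the dimension of the affine hull of $\operatorname{supp}(\mu)$, and $\operatorname{diam}(\mu)=\sup_{\mathbf x,\mathbf y\in\operatorname{supp}(\mu)}\lVert\mathbf x-\mathbf y\rVert$. $\mathcal P_c^*(\mathbb R^2)=\{\mu\in\mathcal P(\mathbb R^2): \operatorname{supp}(\mu)\text{ compact},\ \dim(\mu)>1\}$. $W_\infty(\mu,\nu)=\inf_{\pi\in\Pi(\mu,\nu)}\sup_{(\mathbf x,\mathbf y)\in\operatorname{supp}(\pi)}\lVert\mathbf x-\mathbf y\rVert$, where $\Pi(\mu,\nu)$ is the set of couplings of $\mu$ and $\nu$ (probability measures on $\mathbb R^2\times\mathbb R^2$ with marginals $\mu,\nu$). Restricted Radon transform: $\mathcal R_{\boldsymbol\theta}[\mu]=(S_{\boldsymbol\theta})_\#\mu\in\mathcal P(\mathbb R)$ with $S_{\boldsymbol\theta}(\mathbf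 x)=\langle\mathbf x,\boldsymbol\theta\rangle$. Throughout, $\rho$ is a fixed reference measure: a Borel probability measure on $\mathbb R$ with finite second moment and without atoms. For $\nu\in\mathcal P(\mathbb R)$, $F_\nu(t)=\nu((-\infty,t])$, $F_\nu^{[-1]}(t)=\inf\{s\in\mathbb R: F_\nu(s)>t\}$, and $\widehat\nu=F_\nu^{[-1]}\circ F_\rho$ (finite $\rho$-a.e., namely where $F_\rho\in(0,1)$). For $\mu\in\mathcal P(\mathbb R^2)$, the R-CDT is $\widehat{\mathcal R}_{\boldsymbol\theta}[\mu]=\widehat{\mathcal R}[\mu](\cdot,\boldsymbol\theta)=\widehat{\nu}$ with $\nu=\mathcal R_{\boldsymbol\theta}[\mu]$. For $g\in L^2_\rho(\mathbb R)$: $\operatorname{mean}(g)=\int_{\mathbb R} g\,\mathrm d\rho$, $\operatorname{std}(g)=\bigl(\int_{\mathbb R}\lvert g-\operatorname{mean}(g)\rvert^2\,\mathrm d\rho\bigr)^{1/2}$. The normalized R-CDT is $$\mathcal N_{\boldsymbol\theta}[\mu](t)=\mathcal N[\mu](t,\boldsymbol\theta)=\frac{\widehat{\mathcal R}_{\boldsymbol\theta}[\mu](t)-\operatorname{mean}(\widehat{\mathcal R}_{\boldsymbol\theta}[\mu])}{\operatorname{std}(\widehat{\mathcal R}_{\boldsymbol\theta}[\mu])},$$ and the max-normalized R-CDT is $\mathcal N_{\mathrm m}[\mu](t)=\max_{\boldsymbol\theta\in\mathbb S_1}\mathcal N[\mu](t,\boldsymbol\theta)$. For measures in $\mathcal P_c^*(\mathbb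 R^2)$ these are well defined and $\mathcal N_{\mathrm m}[\mu]\in L^\infty_\rho(\mathbb R)$. $\lVert\cdot\rVert_\infty$ is the norm of $L^\infty_\rho(\mathbb R)$. *)

theory Defs
  imports "HOL-Probability.Probability"
begin

abbreviation borel_probs :: "'a::topological_space measure set" where
  "borel_probs \<equiv> space (prob_algebra borel)"

definition msupp :: "'a::topological_space measure \<Rightarrow> 'a set" where
  "msupp \<mu> = {x. \<forall>U. open U \<and> x \<in> U \<longrightarrow> emeasure \<mu> U > 0}"

definition measure_dim :: "'a::euclidean_space measure \<Rightarrow> int" where
  "measure_dim \<mu> = aff_dim (msupp \<mu>)"

(* diameter agrees with the supremum of the distances only on bounded sets; here it is
   used for compactly supported measures only. *)
definition measure_diam :: "'a::metric_space measure \<Rightarrow> real" where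
  "measure_diam \<mu> = diameter (msupp \<mu>)"

definition Pc_star :: "(real^2) measure set" where
  "Pc_star = {\<mu> \<in> borel_probs. compact (msupp \<mu>) \<and> measure_dim \<mu> > 1}"

definition couplings ::
  "'a::topological_space measure \<Rightarrow> 'b::topological_space measure \<Rightarrow> ('a \<times> 'b) measure set" where
  "couplings \<mu> \<nu> = {\<pi> \<in> borel_probs. distr \<pi> borel fst = \<mu> \<and> distr \<pi> borel snd = \<nu>}"

(* Extended-valued: infinite when every coupling has unbounded displacement. *)
definition W_inf :: "'a::real_normed_vector measure \<Rightarrow> 'a measure \<Rightarrow> ennreal" where
  "W_inf \<mu> \<nu> = (INF \<pi>\<in>couplings \<mu> \<nu>. SUP (x, y)\<in>msupp \<pi>. ennreal (norm (x - y)))"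

definition reference_measure :: "real measure \<Rightarrow> bool" where
  "reference_measure \<rho> \<longleftrightarrow>
     \<rho> \<in> borel_probs \<and> integrable \<rho> (\<lambda>x. x\<^sup>2) \<and> (\<forall>x. measure \<rho> {x} = 0)"

definition radon :: "'a::real_inner \<Rightarrow> 'a measure \<Rightarrow> real measure" where
  "radon \<theta> \<mu> = distr \<mu> borel (\<lambda>x. x \<bullet> \<theta>)"

(* Strict inequality: the right-continuous generalized inverse. For t outside (0,1) the
   real-valued infimum need not be meaningful. *)
definition quantile :: "real measure \<Rightarrow> real \<Rightarrow> real" where
  "quantile \<nu> t = Inf {s. cdf \<nu> s > t}"

(* For a reference measure, cdf \<rho> has values in (0,1) \<rho>-almost everywhere, so the
   exceptional arguments of quantile are irrelevant modulo \<rho>-null sets. *)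
definition cdt :: "real measure \<Rightarrow> real measure \<Rightarrow> real \<Rightarrow> real" where
  "cdt \<rho> \<nu> = quantile \<nu> \<circ> cdf \<rho>"

definition rcdt :: "real measure \<Rightarrow> 'a::real_inner measure \<Rightarrow> 'a \<Rightarrow> real \<Rightarrow> real" where
  "rcdt \<rho> \<mu> \<theta> = cdt \<rho> (radon \<theta> \<mu>)"

definition mean_wrt :: "real measure \<Rightarrow> (real \<Rightarrow> real) \<Rightarrow> real" where
  "mean_wrt \<rho> g = (\<integral>t. g t \<partial>\<rho>)"

definition std_wrt :: "real measure \<Rightarrow> (real \<Rightarrow> real) \<Rightarrow> real" where
  "std_wrt \<rho> g = sqrt (\<integral>t. \<bar>g t - mean_wrt \<rho> g\<bar>\<^sup>2 \<partial>\<rho>)"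

definition nrcdt :: "real measure \<Rightarrow> 'a::real_inner measure \<Rightarrow> 'a \<Rightarrow> real \<Rightarrow> real" where
  "nrcdt \<rho> \<mu> \<theta> t =
     (rcdt \<rho> \<mu> \<theta> t - mean_wrt \<rho> (rcdt \<rho> \<mu> \<theta>)) / std_wrt \<rho> (rcdt \<rho> \<mu> \<theta>)"

(* For \<mu> in Pc_star the supremum is attained wherever cdf \<rho> t lies in (0,1), because
   nrcdt \<rho> \<mu> \<theta> t is then continuous in \<theta>; it is the maximum over the unit circle. *)
definition max_nrcdt :: "real measure \<Rightarrow> (real^2) measure \<Rightarrow> real \<Rightarrow> real" where
  "max_nrcdt \<rho> \<mu> t = (SUP \<theta>\<in>sphere 0 1. nrcdt \<rho> \<mu> \<theta> t)"

(* A minimum for \<mu> in Pc_star, again by continuity in \<theta>. *)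
definition min_std :: "real measure \<Rightarrow> (real^2) measure \<Rightarrow> real" where
  "min_std \<rho> \<mu> = (INF \<theta>\<in>sphere 0 1. std_wrt \<rho> (rcdt \<rho> \<mu> \<theta>))"

definition Linf_norm :: "'a measure \<Rightarrow> ('a \<Rightarrow> real) \<Rightarrow> ereal" where
  "Linf_norm M f = esssup M (\<lambda>x. ereal \<bar>f x\<bar>)"

definition Linf :: "'a measure \<Rightarrow> ('a \<Rightarrow> real) set" where
  "Linf M = {f \<in> borel_measurable M. Linf_norm M f < \<infinity>}"

(* Linf consists of representatives rather than of equivalence classes; invariance under
   a.e. equality makes \<Phi> a functional on the quotient space. *)
definition Linf_continuous_linear_functional ::
  "'a measure \<Rightarrow> (('a \<Rightarrow> real) \<Rightarrow> real) \<Rightarrow> bool" where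
  "Linf_continuous_linear_functional M \<Phi> \<longleftrightarrow>
     (\<forall>f\<in>Linf M. \<forall>g\<in>Linf M. (AE x in M. f x = g x) \<longrightarrow> \<Phi> f = \<Phi> g) \<and>
     (\<forall>f\<in>Linf M. \<forall>g\<in>Linf M. \<Phi> (\<lambda>x. f x + g x) = \<Phi> f + \<Phi> g) \<and>
     (\<forall>a. \<forall>f\<in>Linf M. \<Phi> (\<lambda>x. a * f x) = a * \<Phi> f) \<and>
     (\<forall>f\<in>Linf M. \<forall>e>0. \<exists>d>0. \<forall>g\<in>Linf M.
        Linf_norm M (\<lambda>x. g x - f x) < ereal d \<longrightarrow> \<bar>\<Phi> g - \<Phi> f\<bar> < e)"

(* A functional on all functions is unconstrained outside Linf, so membership in Linf has to
   be required for the separation to be meaningful. *)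
definition linearly_separable_Linf :: "'a measure \<Rightarrow> ('a \<Rightarrow> real) set \<Rightarrow> ('a \<Rightarrow> real) set \<Rightarrow> bool" where
  "linearly_separable_Linf M A B \<longleftrightarrow>
     A \<subseteq> Linf M \<and> B \<subseteq> Linf M \<and>
     (\<exists>\<Phi> c. Linf_continuous_linear_functional M \<Phi> \<and>
        (\<forall>f\<in>A. \<forall>g\<in>B. \<Phi> f < c \<and> c < \<Phi> g))"

definition affine_class :: "real \<Rightarrow> (real^2) measure \<Rightarrow> (real^2) measure set" where
  "affine_class \<epsilon> \<mu>0 = {distr \<mu> borel (\<lambda>x. A *v x + y) | (A :: real^2^2) y \<mu>.
     invertible A \<and> \<mu> \<in> borel_probs \<and> W_inf \<mu> \<mu>0 \<le> ennreal \<epsilon>}"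

end

theory Submission
  imports Defs
begin

text \<open>
  All random variables are compared through quantile functions. If \<open>W_inf \<mu> \<mu>0 \<le> \<epsilon>\<close>, then for every
  \<open>e > \<epsilon>\<close> some coupling moves points by at most \<open>e\<close> almost surely. Projection onto a unit vector does
  not increase distances, so the distribution functions of the projections differ by a shift of at
  most \<open>e\<close>, and letting \<open>e\<close> decrease to \<open>\<epsilon>\<close> shows that the quantile functions differ by at most \<open>\<epsilon>\<close> on
  \<open>(0, 1)\<close> (\<open>quantile_radon_stable\<close>). Attainment of the infimum in the Wasserstein distance is not
  needed. Since the reference measure has no atoms, its distribution function takes values in
  \<open>(0, 1)\<close> almost everywhere (\<open>AE_cdf_in_01\<close>), which transfers the estimate to the transform
  \<open>rcdt\<close>.

  Hence the means of the transforms differ by at most \<open>\<epsilon>\<close> and the standard deviations by at most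
  \<open>2 * \<epsilon>\<close> (\<open>std_wrt_perturb\<close>). For the template, both the distance of the transform from its mean and
  its standard deviation are bounded by the diameter of the support (\<open>template_deviation\<close>), so
  elementary estimates bound the difference of the normalised transforms by
  \<open>4 \<epsilon> (diam + 2 \<epsilon>) / (c (c - 2 \<epsilon>))\<close>, uniformly in the direction (\<open>nrcdt_stable\<close>). This bound passes to
  the supremum over all directions.

  An invertible affine map \<open>x \<mapsto> A x + y\<close> permutes the directions, and rescales and translates each
  projection; the normalisation undoes the latter, so that the max-normalised transform is
  unchanged wherever the reference distribution function lies in \<open>(0, 1)\<close>
  (\<open>max_nrcdt_affine\<close>). Thus each of the two classes is mapped into a
  ball of the above radius around the transform of its template (\<open>max_nrcdt_affine_class\<close>), and the
  hypothesis says that the distance of the centres exceeds the sum of the radii. Such balls in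
  \<open>L\<^sup>\<infinity>\<close> are separated by integration, up to sign, over a set of positive measure on which the
  centres are far apart (\<open>linearly_separable_Linf_balls\<close>).
\<close>

section \<open>Supports and couplings\<close>

lemma AE_in_msupp:
  fixes \<mu> :: "'a::second_countable_topology measure"
  assumes "sets \<mu> = sets borel"
  shows "AE x in \<mu>. x \<in> msupp \<mu>"
proof -
  obtain B :: "'a set set" where B: "countable B" "topological_basis B"
    using ex_countable_basis by blast
  define N where "N = (\<Union>U\<in>{U\<in>B. emeasure \<mu> U = 0}. U)"
  have "U \<in> null_sets \<mu>" if "U \<in> B" "emeasure \<mu> U = 0" for U
    using that topological_basis_open[OF B(2)] assms by (auto simp: null_sets_def)
  then have "N \<in> null_sets \<mu>"
    unfolding N_def by (intro null_sets_UN') (auto intro: countable_subset[OF _ B(1)])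
  moreover have "x \<in> N" if x: "x \<notin> msupp \<mu>" for x
  proof -
    obtain U where U: "open U" "x \<in> U" "emeasure \<mu> U = 0"
      using x by (auto simp: msupp_def)
    then obtain V where V: "V \<in> B" "x \<in> V" "V \<subseteq> U"
      using B(2) by (meson topological_basisE)
    then have "emeasure \<mu> V = 0"
      using U emeasure_mono[of V U \<mu>] assms by (simp add: le_zero_eq)
    then show ?thesis
      using V by (auto simp: N_def)
  qed
  ultimately show ?thesis
    by (intro AE_I'[of N]) auto
qed

lemma W_inf_le_imp_coupling:
  fixes \<mu> \<nu> :: "'a::{real_normed_vector, second_countable_topology} measure"
  assumes "W_inf \<mu> \<nu> \<le> ennreal \<epsilon>" "0 \<le> \<epsilon>" "\<epsilon> < e"
  obtains \<pi> where "\<pi> \<in> couplings \<mu> \<nu>" "AE p in \<pi>. norm (fst p - snd p) \<le> e"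
proof -
  have "W_inf \<mu> \<nu> < ennreal e"
    using assms by (auto intro: le_less_trans simp: ennreal_less_iff)
  then obtain \<pi> where \<pi>: "\<pi> \<in> couplings \<mu> \<nu>"
    and sup: "(SUP (x, y)\<in>msupp \<pi>. ennreal (norm (x - y))) < ennreal e"
    unfolding W_inf_def INF_less_iff by blast
  have "norm (fst p - snd p) \<le> e" if "p \<in> msupp \<pi>" for p
  proof -
    have "ennreal (norm (fst p - snd p)) \<le> (SUP (x, y)\<in>msupp \<pi>. ennreal (norm (x - y)))"
      using that by (intro SUP_upper2[of p]) (auto simp: case_prod_beta)
    with sup have "ennreal (norm (fst p - snd p)) < ennreal e"
      by (rule le_less_trans[rotated])
    then show ?thesis
      by (simp add: ennreal_less_iff)
  qed
  moreover have "AE p in \<pi>. p \<in> msupp \<pi>"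
    using \<pi> by (intro AE_in_msupp) (auto simp: couplings_def space_prob_algebra)
  ultimately have "AE p in \<pi>. norm (fst p - snd p) \<le> e"
    by (auto elim: eventually_mono)
  with \<pi> that show ?thesis by blast
qed

section \<open>Quantile functions\<close>

lemma real_distribution_radon:
  fixes \<mu> :: "'a::euclidean_space measure"
  assumes "\<mu> \<in> borel_probs"
  shows "real_distribution (radon \<theta> \<mu>)"
proof -
  interpret prob_space \<mu>
    using assms by (simp add: space_prob_algebra)
  have [measurable_cong]: "sets \<mu> = sets borel"
    using assms by (simp add: space_prob_algebra)
  show ?thesis
    unfolding radon_def by (rule real_distribution_distr) measurable
qed

context real_distribution
begin

lemma cdf_superlevel_nonempty:
  assumes "u < 1"
  shows "{s. u < cdf M s} \<noteq> {}"
  using eventually_happens'[OF trivial_limit_at_top_linorder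
      order_tendstoD(1)[OF cdf_lim_at_top_prob assms]] by blast

lemma cdf_superlevel_bdd_below:
  assumes "0 < u"
  shows "bdd_below {s. u < cdf M s}"
proof -
  obtain N where "cdf M s < u" if "s \<le> N" for s
    using order_tendstoD(2)[OF cdf_lim_at_bot assms] by (auto simp: eventually_at_bot_linorder)
  then show ?thesis
    by (intro bdd_belowI[of _ N]) (metis linear mem_Collect_eq not_less_iff_gr_or_eq)
qed

lemma quantile_mono:
  assumes "0 < u" "u \<le> v" "v < 1"
  shows "quantile M u \<le> quantile M v"
  unfolding quantile_def
  using assms by (intro cInf_superset_mono cdf_superlevel_nonempty cdf_superlevel_bdd_below) auto

lemma quantile_bounds:
  assumes bnd: "AE x in M. a \<le> x \<and> x \<le> b" and u: "0 < u" "u < 1"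
  shows "a \<le> quantile M u" "quantile M u \<le> b"
proof -
  have "cdf M s = 0" if "s < a" for s
  proof -
    have "AE x in M. x \<notin> {..s}"
      using bnd by eventually_elim (use that in auto)
    then show ?thesis
      unfolding cdf_def by (simp add: prob_eq_0)
  qed
  then show "a \<le> quantile M u"
    unfolding quantile_def using u
    by (intro cInf_greatest cdf_superlevel_nonempty) (auto simp: not_less[symmetric])
  have "AE x in M. x \<in> {..b}"
    using bnd by eventually_elim auto
  then have "cdf M b = 1"
    unfolding cdf_def by (simp add: prob_eq_1)
  then show "quantile M u \<le> b"
    unfolding quantile_def using u by (intro cInf_lower cdf_superlevel_bdd_below) auto
qed

lemma quantile_affine:
  assumes r: "0 < r" and u: "0 < u" "u < 1"
  shows "quantile (distr M borel (\<lambda>s. r * s + c)) u = r * quantile M u + c"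
proof -
  have "cdf (distr M borel (\<lambda>s. r * s + c)) s = cdf M ((s - c) / r)" for s
    unfolding cdf_def using r
    by (subst measure_distr) (auto intro!: arg_cong[where f = prob] simp: field_simps)
  moreover have "u < cdf M ((s - c) / r) \<longleftrightarrow> s \<in> (\<lambda>s. r * s + c) ` {s. u < cdf M s}" for s
    using r by (auto simp: image_iff field_simps intro!: exI[of _ "(s - c) / r"])
  ultimately have "quantile (distr M borel (\<lambda>s. r * s + c)) u
      = Inf ((\<lambda>s. r * s + c) ` {s. u < cdf M s})"
    unfolding quantile_def by simp
  also have "\<dots> = r * Inf {s. u < cdf M s} + c"
    using r u
    by (intro continuous_at_Inf_mono[symmetric] cdf_superlevel_nonempty cdf_superlevel_bdd_below
        monoI continuous_intros) auto
  finally show ?thesis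
    unfolding quantile_def .
qed

end

text \<open>An almost sure bound \<open>Y \<le> X + e\<close> passes to the quantile functions, because the distribution
  function of \<open>X\<close> at \<open>s\<close> is then at most that of \<open>Y\<close> at \<open>s + e\<close>.\<close>
lemma quantile_le_of_AE_le:
  assumes "prob_space \<pi>" and [measurable]: "X \<in> borel_measurable \<pi>" "Y \<in> borel_measurable \<pi>"
    and le: "AE p in \<pi>. Y p \<le> X p + e" and u: "0 < u" "u < 1"
  shows "quantile (distr \<pi> borel Y) u \<le> quantile (distr \<pi> borel X) u + e"
proof -
  interpret prob_space \<pi> by fact
  interpret X: real_distribution "distr \<pi> borel X" by simp
  interpret Y: real_distribution "distr \<pi> borel Y" by simp
  have cdf_le: "cdf (distr \<pi> borel X) s \<le> cdf (distr \<pi> borel Y) (s + e)" for s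
    unfolding cdf_def using le
    by (simp add: measure_distr) (rule finite_measure_mono_AE, auto elim: eventually_mono)
  have "quantile (distr \<pi> borel Y) u - e \<le> s" if "u < cdf (distr \<pi> borel X) s" for s
  proof -
    have "quantile (distr \<pi> borel Y) u \<le> s + e"
      unfolding quantile_def using that cdf_le[of s] u
      by (intro cInf_lower Y.cdf_superlevel_bdd_below) auto
    then show ?thesis by simp
  qed
  then have "quantile (distr \<pi> borel Y) u - e \<le> quantile (distr \<pi> borel X) u"
    unfolding quantile_def[of "distr \<pi> borel X"] using u
    by (intro cInf_greatest X.cdf_superlevel_nonempty) auto
  then show ?thesis by simp
qed

lemma quantile_radon_stable:
  fixes \<mu> \<nu> :: "'a::euclidean_space measure"
  assumes W: "W_inf \<mu> \<nu> \<le> ennreal \<epsilon>" "0 \<le> \<epsilon>" and \<theta>: "norm \<theta> = 1" and u: "0 < u" "u < 1"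
  shows "\<bar>quantile (radon \<theta> \<mu>) u - quantile (radon \<theta> \<nu>) u\<bar> \<le> \<epsilon>"
proof (rule dense_ge)
  fix e assume "\<epsilon> < e"
  then obtain \<pi> where \<pi>: "\<pi> \<in> couplings \<mu> \<nu>" and le: "AE p in \<pi>. norm (fst p - snd p) \<le> e"
    using W_inf_le_imp_coupling W by blast
  have prob: "prob_space \<pi>" and [measurable_cong]: "sets \<pi> = sets borel"
    using \<pi> by (auto simp: couplings_def space_prob_algebra)
  have [measurable]: "fst \<in> borel_measurable \<pi>" "snd \<in> borel_measurable \<pi>"
    by (auto simp: measurable_cong_sets[OF \<open>sets \<pi> = sets borel\<close> refl]
        intro!: borel_measurable_continuous_onI continuous_intros)
  have radon_eq: "radon \<theta> \<mu> = distr \<pi> borel (\<lambda>p. fst p \<bullet> \<theta>)"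
    "radon \<theta> \<nu> = distr \<pi> borel (\<lambda>p. snd p \<bullet> \<theta>)"
    using \<pi> unfolding couplings_def radon_def by (auto simp: distr_distr o_def)
  have "AE p in \<pi>. \<bar>fst p \<bullet> \<theta> - snd p \<bullet> \<theta>\<bar> \<le> e"
    using le
  proof eventually_elim
    case (elim p)
    have "\<bar>fst p \<bullet> \<theta> - snd p \<bullet> \<theta>\<bar> \<le> norm (fst p - snd p)"
      using Cauchy_Schwarz_ineq2[of "fst p - snd p" \<theta>] \<theta> by (simp add: inner_diff_left)
    with elim show ?case by simp
  qed
  then have "quantile (radon \<theta> \<nu>) u \<le> quantile (radon \<theta> \<mu>) u + e"
    "quantile (radon \<theta> \<mu>) u \<le> quantile (radon \<theta> \<nu>) u + e"
    unfolding radon_eq using u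
    by (auto intro!: quantile_le_of_AE_le[OF prob] elim: eventually_mono)
  then show "\<bar>quantile (radon \<theta> \<mu>) u - quantile (radon \<theta> \<nu>) u\<bar> \<le> e"
    by linarith
qed

section \<open>Mean and standard deviation\<close>

lemma std_wrt_nonneg [simp]: "0 \<le> std_wrt \<rho> g"
  by (simp add: std_wrt_def)

lemma mean_wrt_bounds:
  assumes "prob_space \<rho>" "integrable \<rho> f" "AE t in \<rho>. a \<le> f t \<and> f t \<le> b"
  shows "a \<le> mean_wrt \<rho> f" "mean_wrt \<rho> f \<le> b"
proof -
  interpret prob_space \<rho> by fact
  have "(\<integral>t. a \<partial>\<rho>) \<le> (\<integral>t. f t \<partial>\<rho>)" "(\<integral>t. f t \<partial>\<rho>) \<le> (\<integral>t. b \<partial>\<rho>)"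
    using assms(2,3) by (auto intro!: integral_mono_AE simp del: integral_const lebesgue_integral_const)
  then show "a \<le> mean_wrt \<rho> f" "mean_wrt \<rho> f \<le> b"
    by (simp_all add: mean_wrt_def prob_space)
qed

lemma std_wrt_le:
  assumes "prob_space \<rho>" and [measurable]: "f \<in> borel_measurable \<rho>"
    and D: "0 \<le> D" "AE t in \<rho>. \<bar>f t - mean_wrt \<rho> f\<bar> \<le> D"
  shows "std_wrt \<rho> f \<le> D"
proof -
  interpret prob_space \<rho> by fact
  have sq: "AE t in \<rho>. \<bar>f t - mean_wrt \<rho> f\<bar>\<^sup>2 \<le> D\<^sup>2"
    using D(2) by eventually_elim (rule power_mono, auto)
  then have "integrable \<rho> (\<lambda>t. \<bar>f t - mean_wrt \<rho> f\<bar>\<^sup>2)"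
    by (intro integrable_const_bound[of _ "D\<^sup>2"]) auto
  then have "(\<integral>t. \<bar>f t - mean_wrt \<rho> f\<bar>\<^sup>2 \<partial>\<rho>) \<le> (\<integral>t. D\<^sup>2 \<partial>\<rho>)"
    using sq by (intro integral_mono_AE) auto
  then show ?thesis
    unfolding std_wrt_def using D(1) by (auto intro!: real_le_lsqrt simp: prob_space)
qed

text \<open>Centring a perturbation of size \<open>e\<close> at most doubles it, and the standard deviation is the
  \<open>L\<^sup>2\<close>-norm of the centred function, so Minkowski's inequality gives a change of at most
  \<open>2 * e\<close>.\<close>
lemma std_wrt_perturb:
  assumes "prob_space \<rho>" and [measurable]: "f \<in> borel_measurable \<rho>" "g \<in> borel_measurable \<rho>"
    and g: "AE t in \<rho>. \<bar>g t\<bar> \<le> K" and fg: "AE t in \<rho>. \<bar>f t - g t\<bar> \<le> e" and e: "0 \<le> e"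
  shows "\<bar>mean_wrt \<rho> f - mean_wrt \<rho> g\<bar> \<le> e" "\<bar>std_wrt \<rho> f - std_wrt \<rho> g\<bar> \<le> 2 * e"
proof -
  interpret prob_space \<rho> by fact
  have int: "integrable \<rho> g"
    using g by (intro integrable_const_bound) auto
  have int_diff: "integrable \<rho> (\<lambda>t. f t - g t)"
    using fg by (intro integrable_const_bound) auto
  have bnd_diff: "AE t in \<rho>. - e \<le> f t - g t \<and> f t - g t \<le> e"
    using fg by eventually_elim auto
  have f: "AE t in \<rho>. \<bar>f t\<bar> \<le> K + e"
    using g fg by eventually_elim auto
  then have int': "integrable \<rho> f"
    by (intro integrable_const_bound) auto
  have "mean_wrt \<rho> f - mean_wrt \<rho> g = mean_wrt \<rho> (\<lambda>t. f t - g t)"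
    using int int' by (simp add: mean_wrt_def)
  then show mean: "\<bar>mean_wrt \<rho> f - mean_wrt \<rho> g\<bar> \<le> e"
    using mean_wrt_bounds[OF assms(1) int_diff bnd_diff] by linarith
  \<comment> \<open>Minkowski's inequality in one direction: the square is expanded, and the first absolute moment
    is bounded by the root of the second\<close>
  have std_le: "std_wrt \<rho> f \<le> std_wrt \<rho> g + 2 * e"
    if [measurable]: "f \<in> borel_measurable \<rho>" "g \<in> borel_measurable \<rho>"
      and fK: "AE t in \<rho>. \<bar>f t\<bar> \<le> K" and gK: "AE t in \<rho>. \<bar>g t\<bar> \<le> K"
      and fg: "AE t in \<rho>. \<bar>f t - g t\<bar> \<le> e" and mean: "\<bar>mean_wrt \<rho> f - mean_wrt \<rho> g\<bar> \<le> e"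
    for f g and K :: real
  proof -
    define a where "a t = \<bar>g t - mean_wrt \<rho> g\<bar>" for t
    define b where "b t = \<bar>f t - mean_wrt \<rho> f\<bar>" for t
    have [measurable]: "a \<in> borel_measurable \<rho>" "b \<in> borel_measurable \<rho>"
      unfolding a_def b_def by measurable
    have bnd: "AE t in \<rho>. a t \<le> K + \<bar>mean_wrt \<rho> g\<bar>" "AE t in \<rho>. b t \<le> K + \<bar>mean_wrt \<rho> f\<bar>"
      using gK fK by (eventually_elim, simp add: a_def b_def)+
    have nonneg: "0 \<le> a t" "0 \<le> b t" for t
      by (auto simp: a_def b_def)
    have int_a: "integrable \<rho> a"
      using bnd(1) by (intro integrable_const_bound[of _ "K + \<bar>mean_wrt \<rho> g\<bar>"]) (auto simp: nonneg)
    have int_a2: "integrable \<rho> (\<lambda>t. (a t)\<^sup>2)"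
      using bnd(1) by (intro integrable_const_bound[of _ "(K + \<bar>mean_wrt \<rho> g\<bar>)\<^sup>2"])
        (auto elim!: eventually_mono intro!: power_mono simp: nonneg)
    have int_b2: "integrable \<rho> (\<lambda>t. (b t)\<^sup>2)"
      using bnd(2) by (intro integrable_const_bound[of _ "(K + \<bar>mean_wrt \<rho> f\<bar>)\<^sup>2"])
        (auto elim!: eventually_mono intro!: power_mono simp: nonneg)
    have int_up: "integrable \<rho> (\<lambda>t. (a t)\<^sup>2 + 4 * e * a t + 4 * e\<^sup>2)"
      using int_a int_a2 by auto
    have "0 \<le> variance a"
      by (rule variance_positive)
    then have "(expectation a)\<^sup>2 \<le> (\<integral>t. (a t)\<^sup>2 \<partial>\<rho>)"
      using variance_eq[OF int_a int_a2] by simp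
    then have Ea: "expectation a \<le> std_wrt \<rho> g"
      unfolding std_wrt_def a_def by (rule real_le_rsqrt)
    have "(std_wrt \<rho> f)\<^sup>2 = (\<integral>t. (b t)\<^sup>2 \<partial>\<rho>)"
      by (simp add: std_wrt_def b_def)
    also have "\<dots> \<le> (\<integral>t. (a t)\<^sup>2 + 4 * e * a t + 4 * e\<^sup>2 \<partial>\<rho>)"
    proof (rule integral_mono_AE[OF int_b2 int_up])
      show "AE t in \<rho>. (b t)\<^sup>2 \<le> (a t)\<^sup>2 + 4 * e * a t + 4 * e\<^sup>2"
        using fg
      proof eventually_elim
        case (elim t)
        then have "b t \<le> a t + 2 * e"
          using mean unfolding a_def b_def by linarith
        then have "(b t)\<^sup>2 \<le> (a t + 2 * e)\<^sup>2"
          by (intro power_mono nonneg)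
        then show ?case
          by (simp add: power2_eq_square algebra_simps)
      qed
    qed
    also have "\<dots> = (std_wrt \<rho> g)\<^sup>2 + 4 * e * expectation a + 4 * e\<^sup>2"
    proof -
      have "(std_wrt \<rho> g)\<^sup>2 = (\<integral>t. (a t)\<^sup>2 \<partial>\<rho>)"
        by (simp add: std_wrt_def a_def)
      then show ?thesis
        using int_a int_a2 by (simp add: prob_space)
    qed
    also have "\<dots> \<le> (std_wrt \<rho> g)\<^sup>2 + 4 * e * std_wrt \<rho> g + 4 * e\<^sup>2"
      using Ea e by (intro add_mono mult_left_mono) auto
    also have "\<dots> = (std_wrt \<rho> g + 2 * e)\<^sup>2"
      by (simp add: power2_eq_square algebra_simps)
    finally show ?thesis
      by (rule power2_le_imp_le) (use e in simp)
  qed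
  have gK: "AE t in \<rho>. \<bar>g t\<bar> \<le> K + e"
    using g e by (auto elim!: eventually_mono)
  have "std_wrt \<rho> f \<le> std_wrt \<rho> g + 2 * e"
    using f gK fg mean by (intro std_le) auto
  moreover have "std_wrt \<rho> g \<le> std_wrt \<rho> f + 2 * e"
    using f gK fg mean by (intro std_le[of g f "K + e"]) (auto simp: abs_minus_commute)
  ultimately show "\<bar>std_wrt \<rho> f - std_wrt \<rho> g\<bar> \<le> 2 * e"
    by linarith
qed

lemma standardised_diff_le:
  fixes q q0 m m0 s s0 :: real
  assumes q: "\<bar>q - q0\<bar> \<le> e" and m: "\<bar>m - m0\<bar> \<le> e" and s: "\<bar>s - s0\<bar> \<le> 2 * e"
    and D: "\<bar>q0 - m0\<bar> \<le> D" "s0 \<le> D" and c: "c \<le> s0" "2 * e < c"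
  shows "\<bar>(q - m) / s - (q0 - m0) / s0\<bar> \<le> 4 * e * (D + 2 * e) / (c * (c - 2 * e))"
proof -
  have e: "0 \<le> e" using q by linarith
  have pos: "0 < s" "0 < s0" "c - 2 * e \<le> s" "0 < c - 2 * e" "0 < c"
    using s c e by linarith+
  have "(q - m) / s - (q0 - m0) / s0
      = (((q - q0) - (m - m0)) * s0 + (q0 - m0) * (s0 - s)) / (s0 * s)"
    using pos by (simp add: field_simps)
  also have "\<bar>\<dots>\<bar> \<le> (4 * e * D) / (s0 * s)"
  proof -
    have "\<bar>((q - q0) - (m - m0)) * s0\<bar> \<le> (2 * e) * D"
      unfolding abs_mult using q m D pos e by (intro mult_mono) auto
    moreover have "\<bar>(q0 - m0) * (s0 - s)\<bar> \<le> D * (2 * e)"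
      unfolding abs_mult using s D pos by (intro mult_mono) auto
    ultimately have "\<bar>((q - q0) - (m - m0)) * s0 + (q0 - m0) * (s0 - s)\<bar> \<le> 2 * e * D + D * (2 * e)"
      by (rule order_trans[OF abs_triangle_ineq add_mono])
    also have "\<dots> = 4 * e * D"
      by simp
    finally have "\<bar>((q - q0) - (m - m0)) * s0 + (q0 - m0) * (s0 - s)\<bar> \<le> 4 * e * D" .
    then show ?thesis
      using pos by (simp add: abs_divide divide_right_mono)
  qed
  also have "\<dots> \<le> (4 * e * (D + 2 * e)) / (c * (c - 2 * e))"
    using pos e c D by (intro frac_le mult_mono mult_nonneg_nonneg mult_pos_pos) auto
  finally show ?thesis .
qed

section \<open>The normalised transform under an atomless reference measure\<close>

text \<open>A Borel probability measure on the real line without atoms; no moment condition is imposed.\<close>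
locale atomless_distribution = real_distribution \<rho> for \<rho> +
  assumes no_atom: "measure \<rho> {x} = 0"
begin

lemma AE_cdf_in_01: "AE t in \<rho>. 0 < cdf \<rho> t \<and> cdf \<rho> t < 1"
proof -
  have cont: "continuous_on UNIV (cdf \<rho>)"
    using no_atom by (simp add: continuous_on_eq_continuous_at isCont_cdf)
  \<comment> \<open>by continuity the zero set is closed, hence contains its supremum; so it is a null set
    \<open>{..s}\<close>, and the level set of \<open>1\<close> is treated in the same way\<close>
  have "AE t in \<rho>. cdf \<rho> t \<noteq> 0"
  proof (cases "{t. cdf \<rho> t = 0} = {}")
    case False
    have closed: "closed {t. cdf \<rho> t = 0}"
      by (intro closed_Collect_eq cont continuous_intros)
    obtain N where "0 < cdf \<rho> t" if "N \<le> t" for t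
      using order_tendstoD(1)[OF cdf_lim_at_top_prob zero_less_one]
      by (auto simp: eventually_at_top_linorder)
    then have bdd: "bdd_above {t. cdf \<rho> t = 0}"
      by (intro bdd_aboveI[of _ N]) (metis linear mem_Collect_eq less_irrefl)
    define s where "s = Sup {t. cdf \<rho> t = 0}"
    have "cdf \<rho> s = 0"
      using closed_contains_Sup[OF False bdd closed] by (simp add: s_def)
    then have "AE t in \<rho>. t \<notin> {..s}"
      unfolding cdf_def by (simp add: prob_eq_0)
    then show ?thesis
    proof eventually_elim
      case (elim t)
      then show ?case
        using cSup_upper[OF _ bdd, of t] by (auto simp: s_def)
    qed
  qed auto
  moreover have "AE t in \<rho>. cdf \<rho> t \<noteq> 1"
  proof (cases "{t. cdf \<rho> t = 1} = {}")
    case False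
    have closed: "closed {t. cdf \<rho> t = 1}"
      by (intro closed_Collect_eq cont continuous_intros)
    obtain N where "cdf \<rho> t < 1" if "t \<le> N" for t
      using order_tendstoD(2)[OF cdf_lim_at_bot zero_less_one]
      by (auto simp: eventually_at_bot_linorder)
    then have bdd: "bdd_below {t. cdf \<rho> t = 1}"
      by (intro bdd_belowI[of _ N]) (metis linear mem_Collect_eq less_irrefl)
    define s where "s = Inf {t. cdf \<rho> t = 1}"
    have "cdf \<rho> s = 1"
      using closed_contains_Inf[OF False bdd closed] by (simp add: s_def)
    then have "AE t in \<rho>. t \<in> {..s}"
      unfolding cdf_def by (simp add: prob_eq_1)
    moreover have "AE t in \<rho>. t \<notin> {s}"
      using no_atom[of s] by (subst (asm) prob_eq_0) auto
    ultimately show ?thesis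
    proof eventually_elim
      case (elim t)
      then show ?case
        using cInf_lower[OF _ bdd, of t] by (auto simp: s_def)
    qed
  qed auto
  ultimately show ?thesis
    by eventually_elim (use cdf_nonneg cdf_bounded_prob in \<open>auto simp: less_le\<close>)
qed

lemma measurable_cdf [measurable]: "cdf \<rho> \<in> borel_measurable borel"
  by (intro borel_measurable_mono monoI cdf_nondecreasing)

text \<open>Only the values of \<open>G\<close> inside the open unit interval are controlled; at the two end points
  the composition is constant.\<close>
lemma measurable_comp_cdf:
  fixes G :: "real \<Rightarrow> real"
  assumes "mono_on {t. 0 < cdf \<rho> t \<and> cdf \<rho> t < 1} (\<lambda>t. G (cdf \<rho> t))"
  shows "(\<lambda>t. G (cdf \<rho> t)) \<in> borel_measurable \<rho>"
proof -
  let ?J = "{t. 0 < cdf \<rho> t \<and> cdf \<rho> t < 1}"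
  have "(\<lambda>t. if 0 < cdf \<rho> t \<and> cdf \<rho> t < 1 then G (cdf \<rho> t) else if cdf \<rho> t \<le> 0 then G 0 else G 1)
      \<in> borel_measurable borel"
  proof (subst measurable_If_restrict_space_iff)
    show "{x \<in> space borel. 0 < cdf \<rho> x \<and> cdf \<rho> x < 1} \<in> sets borel"
      by measurable
    show "(\<lambda>t. G (cdf \<rho> t)) \<in> borel_measurable (restrict_space borel ?J) \<and>
      (\<lambda>t. if cdf \<rho> t \<le> 0 then G 0 else G 1) \<in> 
        borel_measurable (restrict_space borel {t. \<not> (0 < cdf \<rho> t \<and> cdf \<rho> t < 1)})"
      using borel_measurable_mono_on_fnc[OF assms] by (auto intro!: measurable_restrict_space1)
  qed
  moreover have "(if 0 < cdf \<rho> t \<and> cdf \<rho> t < 1 then G (cdf \<rho> t)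
      else if cdf \<rho> t \<le> 0 then G 0 else G 1) = G (cdf \<rho> t)" for t
    using cdf_nonneg[of t] cdf_bounded_prob[of t] by (auto simp: not_less)
  ultimately show ?thesis
    by simp
qed

lemma rcdt_eq_quantile: "rcdt \<rho> \<mu> \<theta> t = quantile (radon \<theta> \<mu>) (cdf \<rho> t)"
  by (simp add: rcdt_def cdt_def)

lemma rcdt_mono:
  fixes \<mu> :: "'a::euclidean_space measure"
  assumes "\<mu> \<in> borel_probs" "s \<le> t" "0 < cdf \<rho> s" "cdf \<rho> t < 1"
  shows "rcdt \<rho> \<mu> \<theta> s \<le> rcdt \<rho> \<mu> \<theta> t"
proof -
  interpret R: real_distribution "radon \<theta> \<mu>"
    using assms(1) by (rule real_distribution_radon)
  show ?thesis
    unfolding rcdt_eq_quantile using assms by (intro R.quantile_mono cdf_nondecreasing)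
qed

lemma measurable_rcdt:
  fixes \<mu> :: "'a::euclidean_space measure"
  assumes "\<mu> \<in> borel_probs"
  shows "rcdt \<rho> \<mu> \<theta> \<in> borel_measurable \<rho>"
proof -
  have "(\<lambda>t. quantile (radon \<theta> \<mu>) (cdf \<rho> t)) \<in> borel_measurable \<rho>"
    using rcdt_mono[OF assms, of _ _ \<theta>]
    by (intro measurable_comp_cdf mono_onI) (auto simp: rcdt_eq_quantile)
  then show ?thesis
    by (simp add: rcdt_eq_quantile[abs_def])
qed

lemma nrcdt_mono:
  fixes \<mu> :: "'a::euclidean_space measure"
  assumes "\<mu> \<in> borel_probs" "s \<le> t" "0 < cdf \<rho> s" "cdf \<rho> t < 1"
  shows "nrcdt \<rho> \<mu> \<theta> s \<le> nrcdt \<rho> \<mu> \<theta> t"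
  unfolding nrcdt_def using rcdt_mono[OF assms] by (intro divide_right_mono diff_right_mono) auto

lemma sphere_01_nonempty: "sphere 0 1 \<noteq> ({} :: (real^2) set)"
  using vector_choose_size[of 1] by (auto simp: sphere_def dist_norm)

lemma max_nrcdt_in_Linf:
  assumes \<mu>: "\<mu> \<in> borel_probs"
    and bnd: "\<And>\<theta> t. \<lbrakk>norm \<theta> = 1; 0 < cdf \<rho> t; cdf \<rho> t < 1\<rbrakk> \<Longrightarrow> \<bar>nrcdt \<rho> \<mu> \<theta> t\<bar> \<le> B"
  shows "max_nrcdt \<rho> \<mu> \<in> Linf \<rho>"
proof -
  define G where "G u = (SUP \<theta>\<in>sphere 0 1.
    (quantile (radon \<theta> \<mu>) u - mean_wrt \<rho> (rcdt \<rho> \<mu> \<theta>)) / std_wrt \<rho> (rcdt \<rho> \<mu> \<theta>))" for u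
  have G: "max_nrcdt \<rho> \<mu> t = G (cdf \<rho> t)" for t
    by (simp add: max_nrcdt_def G_def nrcdt_def rcdt_eq_quantile)
  have "mono_on {t. 0 < cdf \<rho> t \<and> cdf \<rho> t < 1} (\<lambda>t. G (cdf \<rho> t))"
    unfolding G[symmetric] max_nrcdt_def
  proof (intro mono_onI cSUP_mono sphere_01_nonempty)
    fix s t assume st: "s \<in> {t. 0 < cdf \<rho> t \<and> cdf \<rho> t < 1}" "t \<in> {t. 0 < cdf \<rho> t \<and> cdf \<rho> t < 1}" "s \<le> t"
    show "bdd_above ((\<lambda>\<theta>. nrcdt \<rho> \<mu> \<theta> t) ` sphere 0 1)"
      using st(2) bnd by (intro bdd_aboveI2[of _ _ B]) (force simp: abs_le_iff)
    show "\<exists>\<theta>'\<in>sphere 0 1. nrcdt \<rho> \<mu> \<theta> s \<le> nrcdt \<rho> \<mu> \<theta>' t" if "\<theta> \<in> sphere 0 1" for \<theta>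
      using that st nrcdt_mono[OF \<mu>] by blast
  qed
  then have meas [measurable]: "max_nrcdt \<rho> \<mu> \<in> borel_measurable \<rho>"
    using measurable_comp_cdf by (simp add: G[abs_def])
  have "AE t in \<rho>. ereal \<bar>max_nrcdt \<rho> \<mu> t\<bar> \<le> ereal B"
    using AE_cdf_in_01
  proof eventually_elim
    case (elim t)
    then show ?case
      unfolding max_nrcdt_def ereal_less_eq using bnd sphere_01_nonempty
      by (intro cSup_abs_le) auto
  qed
  then have "Linf_norm \<rho> (max_nrcdt \<rho> \<mu>) \<le> ereal B"
    unfolding Linf_norm_def by (intro esssup_I) auto
  then have "Linf_norm \<rho> (max_nrcdt \<rho> \<mu>) < \<infinity>"
    by (rule le_less_trans) simp
  with meas show ?thesis
    by (simp add: Linf_def)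
qed

lemma max_nrcdt_diff_le:
  assumes diff: "\<And>\<theta>. norm \<theta> = 1 \<Longrightarrow> \<bar>nrcdt \<rho> \<mu> \<theta> t - nrcdt \<rho> \<nu> \<theta> t\<bar> \<le> R"
    and bnd: "\<And>\<theta>. norm \<theta> = 1 \<Longrightarrow> \<bar>nrcdt \<rho> \<nu> \<theta> t\<bar> \<le> B"
  shows "\<bar>max_nrcdt \<rho> \<mu> t - max_nrcdt \<rho> \<nu> t\<bar> \<le> R"
proof -
  have bdd: "bdd_above ((\<lambda>\<theta>. nrcdt \<rho> \<nu> \<theta> t) ` sphere 0 1)"
    using bnd by (intro bdd_aboveI2[of _ _ B]) (force simp: abs_le_iff)
  have bdd': "bdd_above ((\<lambda>\<theta>. nrcdt \<rho> \<mu> \<theta> t) ` sphere 0 1)"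
  proof (intro bdd_aboveI2[of _ _ "B + R"])
    fix \<theta> :: "real^2" assume "\<theta> \<in> sphere 0 1"
    then show "nrcdt \<rho> \<mu> \<theta> t \<le> B + R"
      using bnd[of \<theta>] diff[of \<theta>] by simp
  qed
  have "max_nrcdt \<rho> \<mu> t \<le> max_nrcdt \<rho> \<nu> t + R"
    unfolding max_nrcdt_def[of _ \<mu>]
  proof (intro cSUP_least sphere_01_nonempty)
    fix \<theta> :: "real^2" assume \<theta>: "\<theta> \<in> sphere 0 1"
    then show "nrcdt \<rho> \<mu> \<theta> t \<le> max_nrcdt \<rho> \<nu> t + R"
      using diff[of \<theta>] cSUP_upper[OF \<theta> bdd] by (simp add: max_nrcdt_def)
  qed
  moreover have "max_nrcdt \<rho> \<nu> t \<le> max_nrcdt \<rho> \<mu> t + R"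
    unfolding max_nrcdt_def[of _ \<nu>]
  proof (intro cSUP_least sphere_01_nonempty)
    fix \<theta> :: "real^2" assume \<theta>: "\<theta> \<in> sphere 0 1"
    then show "nrcdt \<rho> \<nu> \<theta> t \<le> max_nrcdt \<rho> \<mu> t + R"
      using diff[of \<theta>] cSUP_upper[OF \<theta> bdd'] by (simp add: max_nrcdt_def)
  qed
  ultimately show ?thesis
    by linarith
qed

section \<open>Invariance under invertible affine maps\<close>

text \<open>The affine map sends the projection in direction \<open>\<theta>\<close> to a translated and positively scaled
  projection in direction \<open>transpose A *v \<theta>\<close>; normalisation removes scale and translation.\<close>
lemma nrcdt_affine:
  fixes A :: "real^'n^'n" and \<mu> :: "(real^'n) measure"
  assumes \<mu>: "\<mu> \<in> borel_probs" and nz: "transpose A *v \<theta> \<noteq> 0"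
    and int: "integrable \<rho> (rcdt \<rho> \<mu> ((transpose A *v \<theta>) /\<^sub>R norm (transpose A *v \<theta>)))"
    and t: "0 < cdf \<rho> t" "cdf \<rho> t < 1"
  shows "nrcdt \<rho> (distr \<mu> borel (\<lambda>x. A *v x + y)) \<theta> t
    = nrcdt \<rho> \<mu> ((transpose A *v \<theta>) /\<^sub>R norm (transpose A *v \<theta>)) t"
proof -
  define r where "r = norm (transpose A *v \<theta>)"
  define \<phi> where "\<phi> = (transpose A *v \<theta>) /\<^sub>R r"
  define c where "c = y \<bullet> \<theta>"
  let ?\<kappa> = "distr \<mu> borel (\<lambda>x. A *v x + y)"
  let ?q = "rcdt \<rho> \<mu> \<phi>" and ?q' = "rcdt \<rho> ?\<kappa> \<theta>"
  have r: "0 < r"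
    using nz by (simp add: r_def)
  have [measurable_cong]: "sets \<mu> = sets borel"
    using \<mu> by (simp add: space_prob_algebra)
  interpret R: real_distribution "radon \<phi> \<mu>"
    using \<mu> by (rule real_distribution_radon)
  have [measurable]: "(\<lambda>x. A *v x + y) \<in> borel_measurable \<mu>"
    by (auto simp: measurable_cong_sets[OF \<open>sets \<mu> = sets borel\<close> refl]
        intro!: borel_measurable_continuous_onI continuous_intros
          matrix_vector_mult_linear_continuous_on)
  have "(A *v x + y) \<bullet> \<theta> = r * (x \<bullet> \<phi>) + c" for x
  proof -
    have "(A *v x) \<bullet> \<theta> = x \<bullet> (transpose A *v \<theta>)"
      by (metis dot_lmul_matrix inner_commute transpose_matrix_vector)
    also have "\<dots> = r * (x \<bullet> \<phi>)"
      using r by (simp add: \<phi>_def)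
    finally show ?thesis
      by (simp add: inner_add_left c_def)
  qed
  then have "radon \<theta> ?\<kappa> = distr (radon \<phi> \<mu>) borel (\<lambda>s. r * s + c)"
    unfolding radon_def by (simp add: distr_distr o_def)
  then have q': "?q' s = r * ?q s + c" if "0 < cdf \<rho> s" "cdf \<rho> s < 1" for s
    using R.quantile_affine[OF r that] by (simp add: rcdt_eq_quantile)
  have AE_q': "AE s in \<rho>. ?q' s = r * ?q s + c"
    using AE_cdf_in_01 by eventually_elim (simp add: q')
  have [measurable]: "?q \<in> borel_measurable \<rho>" "?q' \<in> borel_measurable \<rho>"
    using \<mu> by (auto intro!: measurable_rcdt prob_space.prob_space_distr simp: space_prob_algebra)
  have int_q: "integrable \<rho> ?q"
    using int by (simp add: \<phi>_def r_def)
  have "mean_wrt \<rho> ?q' = (\<integral>s. r * ?q s + c \<partial>\<rho>)"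
    unfolding mean_wrt_def using AE_q' by (intro integral_cong_AE) auto
  also have "\<dots> = r * mean_wrt \<rho> ?q + c"
    using int_q prob_space by (simp add: mean_wrt_def)
  finally have mean: "mean_wrt \<rho> ?q' = r * mean_wrt \<rho> ?q + c" .
  have "(\<integral>s. \<bar>?q' s - mean_wrt \<rho> ?q'\<bar>\<^sup>2 \<partial>\<rho>) = (\<integral>s. r\<^sup>2 * \<bar>?q s - mean_wrt \<rho> ?q\<bar>\<^sup>2 \<partial>\<rho>)"
  proof (rule integral_cong_AE)
    show "AE s in \<rho>. \<bar>?q' s - mean_wrt \<rho> ?q'\<bar>\<^sup>2 = r\<^sup>2 * \<bar>?q s - mean_wrt \<rho> ?q\<bar>\<^sup>2"
      using AE_q'
      by eventually_elim (simp add: mean right_diff_distrib[symmetric] power_mult_distrib)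
  qed auto
  then have "std_wrt \<rho> ?q' = r * std_wrt \<rho> ?q"
    using r by (simp add: std_wrt_def real_sqrt_mult)
  then have "nrcdt \<rho> ?\<kappa> \<theta> t = nrcdt \<rho> \<mu> \<phi> t"
    using r by (simp add: nrcdt_def mean q'[OF t] right_diff_distrib[symmetric])
  then show ?thesis
    by (simp add: \<phi>_def r_def)
qed

lemma transpose_mult_nonzero:
  fixes A :: "real^'n^'n"
  assumes "invertible A" "\<theta> \<noteq> 0"
  shows "transpose A *v \<theta> \<noteq> 0"
proof -
  have "invertible (transpose A)"
    using assms(1) by (metis invertible_def matrix_transpose_mul transpose_mat)
  then show ?thesis
    using assms(2) by (metis inj_matrix_vector_mult injD matrix_vector_mult_0_right)
qed

lemma max_nrcdt_affine:
  fixes A :: "real^2^2"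
  assumes \<mu>: "\<mu> \<in> borel_probs" and A: "invertible A"
    and int: "\<And>\<theta>. norm \<theta> = 1 \<Longrightarrow> integrable \<rho> (rcdt \<rho> \<mu> \<theta>)"
    and t: "0 < cdf \<rho> t" "cdf \<rho> t < 1"
  shows "max_nrcdt \<rho> (distr \<mu> borel (\<lambda>x. A *v x + y)) t = max_nrcdt \<rho> \<mu> t"
proof -
  define \<psi> where "\<psi> \<theta> = (transpose A *v \<theta>) /\<^sub>R norm (transpose A *v \<theta>)" for \<theta>
  have inv: "invertible (transpose A)"
    using A by (metis invertible_def matrix_transpose_mul transpose_mat)
  have nz: "transpose A *v \<theta> \<noteq> 0" if "norm \<theta> = 1" for \<theta>
    using that by (intro transpose_mult_nonzero A) auto
  have norm_\<psi>: "norm (\<psi> \<theta>) = 1" if "norm \<theta> = 1" for \<theta>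
    using nz[OF that] by (simp add: \<psi>_def del: transpose_matrix_vector)
  have "\<phi> \<in> \<psi> ` sphere 0 1" if "norm \<phi> = 1" for \<phi>
  proof -
    obtain w where w: "transpose A *v w = \<phi>"
      using inv by (metis invertible_def matrix_vector_mul_assoc matrix_vector_mul_lid)
    have "w \<noteq> 0"
      using w that by auto
    then have "\<psi> (w /\<^sub>R norm w) = \<phi>"
      using w that by (simp add: \<psi>_def matrix_vector_mult_scaleR)
    moreover have "w /\<^sub>R norm w \<in> sphere 0 1"
      using \<open>w \<noteq> 0\<close> by simp
    ultimately show ?thesis
      by blast
  qed
  then have image: "\<psi> ` sphere 0 1 = sphere 0 1"
    using norm_\<psi> by auto
  have "nrcdt \<rho> (distr \<mu> borel (\<lambda>x. A *v x + y)) \<theta> t = nrcdt \<rho> \<mu> (\<psi> \<theta>) t"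
    if "\<theta> \<in> sphere 0 1" for \<theta>
    unfolding \<psi>_def using that nz[of \<theta>] int[OF norm_\<psi>[of \<theta>]]
    by (intro nrcdt_affine[OF \<mu> _ _ t]) (auto simp: \<psi>_def)
  then have "max_nrcdt \<rho> (distr \<mu> borel (\<lambda>x. A *v x + y)) t
      = (SUP \<theta>\<in>sphere 0 1. nrcdt \<rho> \<mu> (\<psi> \<theta>) t)"
    unfolding max_nrcdt_def by (intro SUP_cong) auto
  also have "\<dots> = (SUP \<phi>\<in>\<psi> ` sphere 0 1. nrcdt \<rho> \<mu> \<phi> t)"
    by (simp add: image_image)
  finally show ?thesis
    by (simp add: image max_nrcdt_def)
qed

section \<open>Stability near a template measure\<close>

text \<open>The projections of a compactly supported measure live in an interval no longer than the
  diameter of the support, and so do the values of their quantile functions.\<close>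
lemma rcdt_template_bounds:
  assumes \<mu>0: "\<mu>0 \<in> Pc_star" and \<theta>: "norm \<theta> = 1"
  obtains a b where "b - a \<le> measure_diam \<mu>0"
    "\<And>t. \<lbrakk>0 < cdf \<rho> t; cdf \<rho> t < 1\<rbrakk> \<Longrightarrow> a \<le> rcdt \<rho> \<mu>0 \<theta> t \<and> rcdt \<rho> \<mu>0 \<theta> t \<le> b"
proof -
  have prob: "\<mu>0 \<in> borel_probs" and compact: "compact (msupp \<mu>0)"
    using \<mu>0 by (auto simp: Pc_star_def)
  have sets [measurable_cong]: "sets \<mu>0 = sets borel"
    using prob by (simp add: space_prob_algebra)
  interpret \<mu>0: prob_space \<mu>0
    using prob by (simp add: space_prob_algebra)
  interpret R: real_distribution "radon \<theta> \<mu>0"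
    using prob by (rule real_distribution_radon)
  have nonempty: "msupp \<mu>0 \<noteq> {}"
  proof
    assume "msupp \<mu>0 = {}"
    with AE_in_msupp[OF sets] show False
      by (simp add: \<mu>0.AE_False)
  qed
  have cont: "continuous_on (msupp \<mu>0) (\<lambda>x. x \<bullet> \<theta>)"
    by (intro continuous_intros)
  obtain p where p: "p \<in> msupp \<mu>0" "\<And>x. x \<in> msupp \<mu>0 \<Longrightarrow> p \<bullet> \<theta> \<le> x \<bullet> \<theta>"
    using continuous_attains_inf[OF compact nonempty cont] by auto
  obtain p' where p': "p' \<in> msupp \<mu>0" "\<And>x. x \<in> msupp \<mu>0 \<Longrightarrow> x \<bullet> \<theta> \<le> p' \<bullet> \<theta>"
    using continuous_attains_sup[OF compact nonempty cont] by auto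
  have "p' \<bullet> \<theta> - p \<bullet> \<theta> \<le> norm (p' - p)"
    using Cauchy_Schwarz_ineq2[of "p' - p" \<theta>] \<theta> by (simp add: inner_diff_left)
  also have "\<dots> \<le> measure_diam \<mu>0"
    using diameter_bounded_bound[OF compact_imp_bounded[OF compact] p'(1) p(1)]
    by (simp add: measure_diam_def dist_norm)
  finally have diam: "p' \<bullet> \<theta> - p \<bullet> \<theta> \<le> measure_diam \<mu>0" .
  have "AE x in \<mu>0. p \<bullet> \<theta> \<le> x \<bullet> \<theta> \<and> x \<bullet> \<theta> \<le> p' \<bullet> \<theta>"
    using AE_in_msupp[OF sets] by eventually_elim (use p p' in auto)
  then have "AE s in radon \<theta> \<mu>0. p \<bullet> \<theta> \<le> s \<and> s \<le> p' \<bullet> \<theta>"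
    unfolding radon_def by (subst AE_distr_iff) auto
  from R.quantile_bounds[OF this] that[OF diam] show ?thesis
    by (simp add: rcdt_eq_quantile)
qed

lemma template_deviation:
  assumes \<mu>0: "\<mu>0 \<in> Pc_star" and \<theta>: "norm \<theta> = 1"
  shows "integrable \<rho> (rcdt \<rho> \<mu>0 \<theta>)"
    and "\<exists>K. \<forall>t. 0 < cdf \<rho> t \<and> cdf \<rho> t < 1 \<longrightarrow> \<bar>rcdt \<rho> \<mu>0 \<theta> t\<bar> \<le> K"
    and "\<lbrakk>0 < cdf \<rho> t; cdf \<rho> t < 1\<rbrakk>
      \<Longrightarrow> \<bar>rcdt \<rho> \<mu>0 \<theta> t - mean_wrt \<rho> (rcdt \<rho> \<mu>0 \<theta>)\<bar> \<le> measure_diam \<mu>0"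
    and "std_wrt \<rho> (rcdt \<rho> \<mu>0 \<theta>) \<le> measure_diam \<mu>0"
proof -
  let ?q = "rcdt \<rho> \<mu>0 \<theta>"
  obtain a b where diam: "b - a \<le> measure_diam \<mu>0"
    and ab: "\<And>t. \<lbrakk>0 < cdf \<rho> t; cdf \<rho> t < 1\<rbrakk> \<Longrightarrow> a \<le> ?q t \<and> ?q t \<le> b"
    using rcdt_template_bounds[OF assms] by metis
  have meas [measurable]: "?q \<in> borel_measurable \<rho>"
    using \<mu>0 by (intro measurable_rcdt) (simp add: Pc_star_def)
  have AE_ab: "AE t in \<rho>. a \<le> ?q t \<and> ?q t \<le> b"
    using AE_cdf_in_01 by eventually_elim (simp add: ab)
  have K: "\<bar>?q t\<bar> \<le> \<bar>a\<bar> + \<bar>b\<bar>" if "0 < cdf \<rho> t \<and> cdf \<rho> t < 1" for t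
    using ab[of t] that by auto
  then show "\<exists>K. \<forall>t. 0 < cdf \<rho> t \<and> cdf \<rho> t < 1 \<longrightarrow> \<bar>?q t\<bar> \<le> K"
    by blast
  have "AE t in \<rho>. \<bar>?q t\<bar> \<le> \<bar>a\<bar> + \<bar>b\<bar>"
    using AE_cdf_in_01 by eventually_elim (rule K)
  then show int: "integrable \<rho> ?q"
    by (intro integrable_const_bound) auto
  have dev: "\<bar>?q t - mean_wrt \<rho> ?q\<bar> \<le> measure_diam \<mu>0" if "0 < cdf \<rho> t" "cdf \<rho> t < 1" for t
    using ab[OF that] diam mean_wrt_bounds[OF prob_space_axioms int AE_ab] by linarith
  then show "\<lbrakk>0 < cdf \<rho> t; cdf \<rho> t < 1\<rbrakk> \<Longrightarrow> \<bar>?q t - mean_wrt \<rho> ?q\<bar> \<le> measure_diam \<mu>0"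
    by blast
  have "a \<le> b"
    using mean_wrt_bounds[OF prob_space_axioms int AE_ab] by linarith
  then show "std_wrt \<rho> ?q \<le> measure_diam \<mu>0"
    using AE_cdf_in_01 dev diam
    by (intro std_wrt_le[OF prob_space_axioms meas]) (auto elim: eventually_mono)
qed

lemma min_std_le:
  assumes "norm \<theta> = 1"
  shows "min_std \<rho> \<mu> \<le> std_wrt \<rho> (rcdt \<rho> \<mu> \<theta>)"
  unfolding min_std_def using assms by (intro cINF_lower bdd_belowI2[of _ 0]) auto

lemma nrcdt_template_bounded:
  assumes \<mu>0: "\<mu>0 \<in> Pc_star" and pos: "0 < min_std \<rho> \<mu>0" and \<theta>: "norm \<theta> = 1"
    and t: "0 < cdf \<rho> t" "cdf \<rho> t < 1"
  shows "\<bar>nrcdt \<rho> \<mu>0 \<theta> t\<bar> \<le> measure_diam \<mu>0 / min_std \<rho> \<mu>0"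
proof -
  have std: "min_std \<rho> \<mu>0 \<le> std_wrt \<rho> (rcdt \<rho> \<mu>0 \<theta>)"
    using \<theta> by (rule min_std_le)
  have "\<bar>rcdt \<rho> \<mu>0 \<theta> t - mean_wrt \<rho> (rcdt \<rho> \<mu>0 \<theta>)\<bar> \<le> measure_diam \<mu>0"
    using template_deviation(3)[OF \<mu>0 \<theta> t] .
  with std pos show ?thesis
    unfolding nrcdt_def abs_divide by (intro frac_le) auto
qed

lemma nrcdt_stable:
  assumes \<mu>0: "\<mu>0 \<in> Pc_star" and \<mu>: "\<mu> \<in> borel_probs"
    and W: "W_inf \<mu> \<mu>0 \<le> ennreal \<epsilon>" "0 \<le> \<epsilon>" and \<epsilon>: "2 * \<epsilon> < min_std \<rho> \<mu>0"
    and \<theta>: "norm \<theta> = 1"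
  shows "integrable \<rho> (rcdt \<rho> \<mu> \<theta>)"
    and "\<lbrakk>0 < cdf \<rho> t; cdf \<rho> t < 1\<rbrakk> \<Longrightarrow> \<bar>nrcdt \<rho> \<mu> \<theta> t - nrcdt \<rho> \<mu>0 \<theta> t\<bar>
      \<le> 4 * \<epsilon> * (measure_diam \<mu>0 + 2 * \<epsilon>) / (min_std \<rho> \<mu>0 * (min_std \<rho> \<mu>0 - 2 * \<epsilon>))"
proof -
  let ?q = "rcdt \<rho> \<mu> \<theta>" and ?p = "rcdt \<rho> \<mu>0 \<theta>"
  have meas [measurable]: "?q \<in> borel_measurable \<rho>" "?p \<in> borel_measurable \<rho>"
    using \<mu> \<mu>0 by (auto intro!: measurable_rcdt simp: Pc_star_def)
  have q: "\<bar>?q t - ?p t\<bar> \<le> \<epsilon>" if "0 < cdf \<rho> t" "cdf \<rho> t < 1" for t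
    unfolding rcdt_eq_quantile by (rule quantile_radon_stable[OF W \<theta> that])
  have AE_q: "AE t in \<rho>. \<bar>?q t - ?p t\<bar> \<le> \<epsilon>"
    using AE_cdf_in_01 by eventually_elim (simp add: q)
  obtain K where K: "\<And>t. 0 < cdf \<rho> t \<and> cdf \<rho> t < 1 \<Longrightarrow> \<bar>?p t\<bar> \<le> K"
    using template_deviation(2)[OF \<mu>0 \<theta>] by blast
  have AE_K: "AE t in \<rho>. \<bar>?p t\<bar> \<le> K"
    using AE_cdf_in_01 by eventually_elim (rule K)
  have "AE t in \<rho>. \<bar>?q t\<bar> \<le> K + \<epsilon>"
    using AE_q AE_K by eventually_elim auto
  then show "integrable \<rho> ?q"
    by (intro integrable_const_bound) auto
  note perturb = std_wrt_perturb[OF prob_space_axioms meas AE_K AE_q \<open>0 \<le> \<epsilon>\<close>]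
  show "\<bar>nrcdt \<rho> \<mu> \<theta> t - nrcdt \<rho> \<mu>0 \<theta> t\<bar>
      \<le> 4 * \<epsilon> * (measure_diam \<mu>0 + 2 * \<epsilon>) / (min_std \<rho> \<mu>0 * (min_std \<rho> \<mu>0 - 2 * \<epsilon>))"
    if t: "0 < cdf \<rho> t" "cdf \<rho> t < 1"
    unfolding nrcdt_def
    by (intro standardised_diff_le q t perturb template_deviation \<mu>0 \<theta> min_std_le \<epsilon>)
qed

lemma max_nrcdt_affine_class:
  assumes \<mu>0: "\<mu>0 \<in> Pc_star" and \<epsilon>: "0 \<le> \<epsilon>" "2 * \<epsilon> < min_std \<rho> \<mu>0"
    and \<kappa>: "\<kappa> \<in> affine_class \<epsilon> \<mu>0"
  shows "max_nrcdt \<rho> \<kappa> \<in> Linf \<rho>"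
    and "AE t in \<rho>. \<bar>max_nrcdt \<rho> \<kappa> t - max_nrcdt \<rho> \<mu>0 t\<bar>
      \<le> 4 * \<epsilon> * (measure_diam \<mu>0 + 2 * \<epsilon>) / (min_std \<rho> \<mu>0 * (min_std \<rho> \<mu>0 - 2 * \<epsilon>))"
proof -
  let ?R = "4 * \<epsilon> * (measure_diam \<mu>0 + 2 * \<epsilon>) / (min_std \<rho> \<mu>0 * (min_std \<rho> \<mu>0 - 2 * \<epsilon>))"
  let ?B = "measure_diam \<mu>0 / min_std \<rho> \<mu>0"
  obtain A :: "real^2^2" and y \<mu> where \<kappa>_eq: "\<kappa> = distr \<mu> borel (\<lambda>x. A *v x + y)"
    and A: "invertible A" and \<mu>: "\<mu> \<in> borel_probs" and W: "W_inf \<mu> \<mu>0 \<le> ennreal \<epsilon>"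
    using \<kappa> by (auto simp: affine_class_def)
  note stable = nrcdt_stable[OF \<mu>0 \<mu> W \<epsilon>]
  have bnd0: "\<bar>nrcdt \<rho> \<mu>0 \<theta> t\<bar> \<le> ?B" if "norm \<theta> = 1" "0 < cdf \<rho> t" "cdf \<rho> t < 1" for \<theta> t
    using \<epsilon> that by (intro nrcdt_template_bounded \<mu>0) auto
  have bnd: "\<bar>nrcdt \<rho> \<mu> \<theta> t\<bar> \<le> ?B + ?R" if "norm \<theta> = 1" "0 < cdf \<rho> t" "cdf \<rho> t < 1" for \<theta> t
    using stable(2)[of \<theta> t] bnd0[of \<theta> t] that by linarith
  have inv: "max_nrcdt \<rho> \<kappa> t = max_nrcdt \<rho> \<mu> t" if "0 < cdf \<rho> t" "cdf \<rho> t < 1" for t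
    unfolding \<kappa>_eq using that by (intro max_nrcdt_affine \<mu> A stable)
  show "AE t in \<rho>. \<bar>max_nrcdt \<rho> \<kappa> t - max_nrcdt \<rho> \<mu>0 t\<bar> \<le> ?R"
    using AE_cdf_in_01
  proof eventually_elim
    case (elim t)
    then show ?case
      unfolding inv[OF conjunct1[OF elim] conjunct2[OF elim]]
      by (intro max_nrcdt_diff_le[where B = ?B] stable bnd0) auto
  qed
  have \<kappa>_prob: "\<kappa> \<in> borel_probs"
    using \<mu> unfolding \<kappa>_eq
    by (auto simp: space_prob_algebra measurable_cong_sets[of \<mu> borel borel borel]
        intro!: prob_space.prob_space_distr borel_measurable_continuous_onI continuous_intros
          matrix_vector_mult_linear_continuous_on)
  show "max_nrcdt \<rho> \<kappa> \<in> Linf \<rho>"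
  proof (rule max_nrcdt_in_Linf[OF \<kappa>_prob])
    fix \<theta> t assume \<theta>: "norm (\<theta> :: real^2) = 1" and t: "0 < cdf \<rho> t" "cdf \<rho> t < 1"
    define \<phi> where "\<phi> = (transpose A *v \<theta>) /\<^sub>R norm (transpose A *v \<theta>)"
    have nz: "transpose A *v \<theta> \<noteq> 0"
      using \<theta> by (intro transpose_mult_nonzero A) auto
    then have \<phi>: "norm \<phi> = 1"
      by (simp add: \<phi>_def del: transpose_matrix_vector)
    have "nrcdt \<rho> \<kappa> \<theta> t = nrcdt \<rho> \<mu> \<phi> t"
      unfolding \<kappa>_eq \<phi>_def
      by (rule nrcdt_affine[OF \<mu> nz stable(1)[OF \<phi>, unfolded \<phi>_def] t])
    then show "\<bar>nrcdt \<rho> \<kappa> \<theta> t\<bar> \<le> ?B + ?R"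
      using bnd[OF \<phi> t] by simp
  qed
qed

end

section \<open>Separation of balls in the essentially bounded functions\<close>

lemma Linf_AE_bounded:
  assumes "f \<in> Linf M"
  obtains B where "AE x in M. \<bar>f x\<bar> \<le> B"
proof -
  have meas [measurable]: "f \<in> borel_measurable M" and fin: "Linf_norm M f < \<infinity>"
    using assms by (auto simp: Linf_def)
  obtain B where B: "Linf_norm M f < ereal B"
    using ereal_dense2[OF fin] by auto
  have "AE x in M. ereal \<bar>f x\<bar> \<le> Linf_norm M f"
    unfolding Linf_norm_def by (rule esssup_AE)
  then have "AE x in M. \<bar>f x\<bar> \<le> B"
    by eventually_elim (use B in \<open>auto dest: le_less_trans\<close>)
  with that show ?thesis .
qed

context prob_space
begin

lemma integrable_sign_indicator_Linf:
  assumes T [measurable]: "T \<in> sets M" and f: "f \<in> Linf M"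
  shows "integrable M (\<lambda>x. \<sigma> * indicator T x * f x)"
proof -
  obtain B where "AE x in M. \<bar>f x\<bar> \<le> B"
    using Linf_AE_bounded[OF f] .
  then have "integrable M f"
    using f by (intro integrable_const_bound) (auto simp: Linf_def)
  then have "integrable M (\<lambda>x. \<sigma> * (f x * indicator T x))"
    by (intro integrable_mult_right integrable_real_mult_indicator T)
  then show ?thesis
    by (simp add: ac_simps)
qed

lemma Linf_continuous_linear_functional_integral:
  assumes T [measurable]: "T \<in> sets M" and \<sigma>: "\<bar>\<sigma>\<bar> = (1::real)"
  shows "Linf_continuous_linear_functional M (\<lambda>f. \<integral>x. \<sigma> * indicator T x * f x \<partial>M)"
proof -
  define \<Phi> where "\<Phi> f = (\<integral>x. \<sigma> * indicator T x * f x \<partial>M)" for f :: "'a \<Rightarrow> real"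
  have meas: "f \<in> borel_measurable M" if "f \<in> Linf M" for f
    using that by (simp add: Linf_def)
  note int = integrable_sign_indicator_Linf[OF T]
  have "\<Phi> f = \<Phi> g" if "f \<in> Linf M" "g \<in> Linf M" "AE x in M. f x = g x" for f g
    unfolding \<Phi>_def
  proof (rule integral_cong_AE)
    show "AE x in M. \<sigma> * indicator T x * f x = \<sigma> * indicator T x * g x"
      using that(3) by eventually_elim simp
  qed (use meas[OF that(1)] meas[OF that(2)] in auto)
  moreover have add: "\<Phi> (\<lambda>x. f x + g x) = \<Phi> f + \<Phi> g" if "f \<in> Linf M" "g \<in> Linf M" for f g
    using int[OF that(1)] int[OF that(2)] by (simp add: \<Phi>_def distrib_left)
  moreover have "\<Phi> (\<lambda>x. a * f x) = a * \<Phi> f" for a f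
    unfolding \<Phi>_def by (simp add: mult.left_commute)
  moreover have "\<exists>d>0. \<forall>g\<in>Linf M. Linf_norm M (\<lambda>x. g x - f x) < ereal d \<longrightarrow> \<bar>\<Phi> g - \<Phi> f\<bar> < e"
    if f: "f \<in> Linf M" and e: "0 < e" for f e
  proof (intro exI[of _ "e / 2"] conjI ballI impI)
    fix g assume g: "g \<in> Linf M" and near: "Linf_norm M (\<lambda>x. g x - f x) < ereal (e / 2)"
    have [measurable]: "f \<in> borel_measurable M" "g \<in> borel_measurable M"
      using f g by (auto intro: meas)
    have "AE x in M. ereal \<bar>g x - f x\<bar> \<le> Linf_norm M (\<lambda>x. g x - f x)"
      unfolding Linf_norm_def by (rule esssup_AE)
    then have AE: "AE x in M. \<bar>\<sigma> * indicator T x * (g x - f x)\<bar> \<le> e / 2"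
    proof eventually_elim
      case (elim x)
      then have "ereal \<bar>g x - f x\<bar> < ereal (e / 2)"
        using near by (rule le_less_trans)
      then show ?case
        using \<sigma> e by (auto simp: abs_mult indicator_def)
    qed
    have "\<Phi> g - \<Phi> f = (\<integral>x. \<sigma> * indicator T x * (g x - f x) \<partial>M)"
      using int[OF f] int[OF g] by (simp add: \<Phi>_def right_diff_distrib)
    also have "\<bar>\<dots>\<bar> \<le> (\<integral>x. \<bar>\<sigma> * indicator T x * (g x - f x)\<bar> \<partial>M)"
      by (rule integral_abs_bound)
    also have "\<dots> \<le> (\<integral>x. e / 2 \<partial>M)"
      using AE e by (intro integral_mono_AE integrable_const_bound[of _ "e / 2"]) auto
    also have "\<dots> < e"
      using e by (simp add: prob_space)
    finally show "\<bar>\<Phi> g - \<Phi> f\<bar> < e" .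
  qed (use e in simp)
  ultimately show ?thesis
    unfolding Linf_continuous_linear_functional_def \<Phi>_def[symmetric] by blast
qed

text \<open>On a set of positive measure the two centres differ by more than the sum of the radii, with a
  constant sign. Integration over this set separates the balls, which gives an explicit functional
  in place of one supplied by the Hahn-Banach theorem.\<close>
lemma linearly_separable_Linf_balls:
  assumes h: "h \<in> Linf M" and k: "k \<in> Linf M"
    and F: "F \<subseteq> Linf M" "\<And>f. f \<in> F \<Longrightarrow> AE x in M. \<bar>f x - h x\<bar> \<le> r"
    and G: "G \<subseteq> Linf M" "\<And>g. g \<in> G \<Longrightarrow> AE x in M. \<bar>g x - k x\<bar> \<le> s"
    and sep: "ereal (r + s) < Linf_norm M (\<lambda>x. h x - k x)"
  shows "linearly_separable_Linf M F G"
proof -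
  have [measurable]: "h \<in> borel_measurable M" "k \<in> borel_measurable M"
    using h k by (auto simp: Linf_def)
  obtain \<delta> where \<delta>: "r + s < \<delta>" "ereal \<delta> < Linf_norm M (\<lambda>x. h x - k x)"
    using ereal_dense2[OF sep] by auto
  define P where "P = {x \<in> space M. \<delta> < k x - h x}"
  define N where "N = {x \<in> space M. \<delta> < h x - k x}"
  have [measurable]: "P \<in> sets M" "N \<in> sets M"
    unfolding P_def N_def by measurable
  have "0 < emeasure M {x \<in> space M. ereal \<delta> < ereal \<bar>h x - k x\<bar>}"
    using \<delta>(2) unfolding Linf_norm_def by (intro esssup_pos_measure) auto
  also have "{x \<in> space M. ereal \<delta> < ereal \<bar>h x - k x\<bar>} = P \<union> N"
    by (auto simp: P_def N_def)
  finally have "0 < prob (P \<union> N)"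
    by (simp add: emeasure_eq_measure)
  also have "\<dots> \<le> prob P + prob N"
    by (rule measure_Un_le) auto
  finally have "0 < prob P \<or> 0 < prob N"
    by linarith
  then obtain T \<sigma> where T [measurable]: "T \<in> sets M" and pos: "0 < prob T"
    and \<sigma>: "\<bar>\<sigma>\<bar> = (1::real)" and gap: "\<And>x. x \<in> T \<Longrightarrow> \<delta> < \<sigma> * (k x - h x)"
  proof
    assume "0 < prob P"
    then show thesis
      by (intro that[of P 1]) (auto simp: P_def)
  next
    assume "0 < prob N"
    then show thesis
      by (intro that[of N "- 1"]) (auto simp: N_def)
  qed
  define \<Phi> where "\<Phi> f = (\<integral>x. \<sigma> * indicator T x * f x \<partial>M)" for f :: "'a \<Rightarrow> real"
  note int = integrable_sign_indicator_Linf[OF T]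
  \<comment> \<open>only the values on the set of integration matter, so a lower bound there suffices\<close>
  have \<Phi>_mono: "\<Phi> f + b * prob T \<le> \<Phi> g"
    if f: "f \<in> Linf M" and g: "g \<in> Linf M" and ge: "AE x in M. x \<in> T \<longrightarrow> b \<le> \<sigma> * (g x - f x)"
    for f g b
  proof -
    have "b * prob T = (\<integral>x. b * indicator T x \<partial>M)"
      by simp
    also have "\<dots> \<le> (\<integral>x. \<sigma> * indicator T x * g x - \<sigma> * indicator T x * f x \<partial>M)"
    proof (rule integral_mono_AE)
      show "AE x in M. b * indicator T x \<le> \<sigma> * indicator T x * g x - \<sigma> * indicator T x * f x"
        using ge by eventually_elim (auto simp: indicator_def right_diff_distrib)
      show "integrable M (\<lambda>x. b * indicator T x)"
        by (intro integrable_mult_right integrable_real_indicator) (auto simp: emeasure_eq_measure)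
    qed (use int[OF f] int[OF g] in auto)
    also have "\<dots> = \<Phi> g - \<Phi> f"
      using int[OF f] int[OF g] by (simp add: \<Phi>_def)
    finally show ?thesis
      by simp
  qed
  have near: "- b \<le> \<sigma> * z \<and> - b \<le> \<sigma> * - z" if "\<bar>z\<bar> \<le> b" for z b :: real
    using \<sigma> that by (auto simp: abs_if split: if_splits)
  \<comment> \<open>the level leaves half of the slack between gap and radii on either side\<close>
  define c where "c = \<Phi> h + (r + (\<delta> - (r + s)) / 2) * prob T"
  have slack: "0 < (\<delta> - (r + s)) / 2 * prob T"
    using \<delta>(1) pos by simp
  have "\<Phi> f < c" if f: "f \<in> F" for f
  proof -
    have "\<Phi> f + - r * prob T \<le> \<Phi> h"
      using F(1) f h F(2)[OF f] by (intro \<Phi>_mono) (auto elim!: eventually_mono dest: near)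
    with slack show ?thesis
      by (simp add: c_def field_simps)
  qed
  moreover have "c < \<Phi> g" if g: "g \<in> G" for g
  proof -
    have "\<Phi> k + - s * prob T \<le> \<Phi> g"
      using G(1) g k G(2)[OF g] by (intro \<Phi>_mono) (auto elim!: eventually_mono dest: near)
    moreover have "\<Phi> h + \<delta> * prob T \<le> \<Phi> k"
      using h k gap by (intro \<Phi>_mono) (auto intro: less_imp_le)
    ultimately show ?thesis
      using slack by (simp add: c_def field_simps)
  qed
  moreover have "Linf_continuous_linear_functional M \<Phi>"
    unfolding \<Phi>_def[abs_def] by (rule Linf_continuous_linear_functional_integral[OF T \<sigma>])
  ultimately show ?thesis
    using F(1) G(1) unfolding linearly_separable_Linf_def by blast
qed

end

theorem theorem4p9:
  fixes \<rho> :: "real measure"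
    and \<mu>0 \<nu>0 :: "(real^2) measure"
    and \<epsilon> c_mu c_nu :: real
    and F0 G0 :: "(real^2) measure set"
  assumes "reference_measure \<rho>"
    and "\<mu>0 \<in> Pc_star" and "\<nu>0 \<in> Pc_star"
    and "\<not> (AE t in \<rho>. max_nrcdt \<rho> \<mu>0 t = max_nrcdt \<rho> \<nu>0 t)"
    and "c_mu = min_std \<rho> \<mu>0" and "c_nu = min_std \<rho> \<nu>0"
    and "0 \<le> \<epsilon>" and "\<epsilon> < min c_mu c_nu / 2"
    and "ereal (4 * \<epsilon> * ((measure_diam \<mu>0 + 2 * \<epsilon>) / (c_mu * (c_mu - 2 * \<epsilon>))
                        + (measure_diam \<nu>0 + 2 * \<epsilon>) / (c_nu * (c_nu - 2 * \<epsilon>))))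
         < Linf_norm \<rho> (\<lambda>t. max_nrcdt \<rho> \<mu>0 t - max_nrcdt \<rho> \<nu>0 t)"
    and "F0 \<noteq> {}" and "F0 \<subseteq> affine_class \<epsilon> \<mu>0"
    and "G0 \<noteq> {}" and "G0 \<subseteq> affine_class \<epsilon> \<nu>0"
  shows "linearly_separable_Linf \<rho> (max_nrcdt \<rho> ` F0) (max_nrcdt \<rho> ` G0)"
proof -
  interpret atomless_distribution \<rho>
    using assms(1)
    by (simp add: reference_measure_def space_prob_algebra atomless_distribution_def
        real_distribution_def real_distribution_axioms_def atomless_distribution_axioms_def)
  have \<epsilon>: "2 * \<epsilon> < min_std \<rho> \<mu>0" "2 * \<epsilon> < min_std \<rho> \<nu>0"
    using assms(5,6,8) by auto
  let ?R = "\<lambda>\<mu>. 4 * \<epsilon> * (measure_diam \<mu> + 2 * \<epsilon>) / (min_std \<rho> \<mu> * (min_std \<rho> \<mu> - 2 * \<epsilon>))"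
  have Linf0: "max_nrcdt \<rho> \<mu> \<in> Linf \<rho>" if "\<mu> \<in> Pc_star" "2 * \<epsilon> < min_std \<rho> \<mu>" for \<mu>
    using that assms(7)
    by (intro max_nrcdt_in_Linf[where B = "measure_diam \<mu> / min_std \<rho> \<mu>"]
        nrcdt_template_bounded) (auto simp: Pc_star_def)
  show ?thesis
  proof (rule linearly_separable_Linf_balls)
    show "max_nrcdt \<rho> \<mu>0 \<in> Linf \<rho>" "max_nrcdt \<rho> \<nu>0 \<in> Linf \<rho>"
      using Linf0 assms(2,3) \<epsilon> by auto
    show "max_nrcdt \<rho> ` F0 \<subseteq> Linf \<rho>"
      using max_nrcdt_affine_class(1)[OF assms(2,7) \<epsilon>(1)] assms(11) by blast
    show "max_nrcdt \<rho> ` G0 \<subseteq> Linf \<rho>"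
      using max_nrcdt_affine_class(1)[OF assms(3,7) \<epsilon>(2)] assms(13) by blast
    show "AE t in \<rho>. \<bar>f t - max_nrcdt \<rho> \<mu>0 t\<bar> \<le> ?R \<mu>0" if "f \<in> max_nrcdt \<rho> ` F0" for f
      using max_nrcdt_affine_class(2)[OF assms(2,7) \<epsilon>(1)] assms(11) that by blast
    show "AE t in \<rho>. \<bar>g t - max_nrcdt \<rho> \<nu>0 t\<bar> \<le> ?R \<nu>0" if "g \<in> max_nrcdt \<rho> ` G0" for g
      using max_nrcdt_affine_class(2)[OF assms(3,7) \<epsilon>(2)] assms(13) that by blast
    show "ereal (?R \<mu>0 + ?R \<nu>0) < Linf_norm \<rho> (\<lambda>t. max_nrcdt \<rho> \<mu>0 t - max_nrcdt \<rho> \<nu>0 t)"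
      using assms(9) unfolding assms(5,6) by (simp add: distrib_left)
  qed
qed

end
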